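(* Let $\eta$ be a continuous partial action of a topological group $G$ on a topological space $X$, let $\pi_G:X\to X/\!\sim_G$ be its orbit quotient map, let $\mu$ be the enveloping action of $G$ on the enveloping space $X_G$, let $\Pi_G:X_G\to X_G/\!\sim_G$ be the orbit quotient map of $\mu$, let $\iota:X\to X_G$, $x\mapsto[1,x]$, and let $\hat\Pi_G:G\times X\to X_G$ be the orbit quotient map of the partial action $\hat\eta$ of $G$ on $G\times X$. Then the following statements hold. (i) If $\pi_G$ has a continuous section, so does $\Pi_G$. (ii) If $G*X$ is open in $G\times X$ and $q$ is a continuous section of $\Pi_G$ such that $\operatorname{im} q\subseteq\iota(X)$, then $\pi_G$ has a continuous section. (iii) If $\Pi_G$ and $\hat\Pi_G$ have continuous sections, then $\pi_G$ has a continuous section.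
   Context: A partial action $\eta$ of a group $G$ (with identity $1$) on a set $X$ is a partially defined map $G\times X\to X$, $(g,x)\mapsto g\cdot x$ (write $\exists g\cdot x$ when $g\cdot x$ is defined), such that for all $g,h\in G$, $x\in X$: (PA1) if $\exists g\cdot x$, then $\exists g^{-1}\cdot(g\cdot x)$ and $g^{-1}\cdot(g\cdot x)=x$; (PA2) if $\exists g\cdot(h\cdot x)$, then $\exists (gh)\cdot x$ and $g\cdot(h\cdot x)=(gh)\cdot x$; (PA3) $\exists 1\cdot x$ and $1\cdot x=x$. Put $G*X=\{(g,x)\in G\times X: \exists g\cdot x\}$ (the domain of $\eta$), $X_g=\{x\in X:\exists g^{-1}\cdot x\}$, and $\eta_g:X_{g^{-1}}\to X_g$, $x\mapsto g\cdot x$ (a bijection). When $G$ is a topological group and $X$ a topological space, $G\times X$ has the product topology and $G*X$ the subspace topology; $\eta$ is topological if every $X_g$ is open in $X$ and every $\eta_g$ is a homeomorphism; $\eta$ is a continuous partial action if it is topological and $\eta:G*X\to X$ is continuous. For a (partial or global) action of $G$ on a space $Z$, the orbit equivalence relation $\sim_G$ is: $z\sim_G w$ if and only if there is $g\in G$ with $g\cdot z$ defined and $g\cdot z=w$; the orbit space $Z/\!\sim_G$ has the quotient topology and the orbit quotient map sends $z$ to its orbit. A continuous section of a quotient map $p:Z\to Z/\!\sim_G$ is a continuous map $s:Z/\!\sim_G\to Z$ with $p\circ s=\mathrm{id}$. The enveloping space of $X$ is $X_G=(G\times X)/R$ with the quotient topology, where $(g,x)R(h,y)\iff x\in X_{g^{-1}h}$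 and $\eta_{h^{-1}g}(x)=y$; $[g,x]$ denotes the class of $(g,x)$. The enveloping action is $\mu:G\times X_G\to X_G$, $(g,[h,x])\mapsto[gh,x]$, which is a continuous global action. The partial action $\hat\eta$ of $G$ on $G\times X$ is given by the bijections $\hat\eta_g:G\times X_{g^{-1}}\to G\times X_g$, $(h,x)\mapsto(hg^{-1},\eta_g(x))$, $g\in G$. Its orbit space is $X_G$ (the orbit of $(g,x)$ under $\hat\eta$ is the class $[g,x]$), so $\hat\Pi_G(g,x)=[g,x]$. *)

theory Defs
  imports "HOL-Analysis.Analysis" "HOL-Algebra.Group"
begin

section \<open>Quotient spaces and continuous sections\<close>

definition quotient_topology :: "'a topology \<Rightarrow> ('a \<times> 'a) set \<Rightarrow> 'a set topology" where
  "quotient_topology Z r = topology (\<lambda>U. U \<subseteq> topspace Z // r \<and> openin Z {z \<in> topspace Z. r `` {z} \<in> U})"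

lemma openin_quotient_topology:
  "openin (quotient_topology Z r) U \<longleftrightarrow>
     U \<subseteq> topspace Z // r \<and> openin Z {z \<in> topspace Z. r `` {z} \<in> U}"
proof -
  have "istopology (\<lambda>U. U \<subseteq> topspace Z // r \<and> openin Z {z \<in> topspace Z. r `` {z} \<in> U})"
    unfolding istopology_def
  proof (intro conjI allI impI)
    fix S T
    assume "S \<subseteq> topspace Z // r \<and> openin Z {z \<in> topspace Z. r `` {z} \<in> S}"
      and "T \<subseteq> topspace Z // r \<and> openin Z {z \<in> topspace Z. r `` {z} \<in> T}"
    moreover have "{z \<in> topspace Z. r `` {z} \<in> S \<inter> T} =
        {z \<in> topspace Z. r `` {z} \<in> S} \<inter> {z \<in> topspace Z. r `` {z} \<in> T}"
      by blast
    ultimately show "S \<inter> T \<subseteq> topspace Z // r" "openin Z {z \<in> topspace Z. r `` {z} \<in> S \<inter> T}"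
      by auto
  next
    fix \<K>
    assume K: "\<forall>K\<in>\<K>. K \<subseteq> topspace Z // r \<and> openin Z {z \<in> topspace Z. r `` {z} \<in> K}"
    then show "\<Union>\<K> \<subseteq> topspace Z // r"
      by blast
    have "{z \<in> topspace Z. r `` {z} \<in> \<Union>\<K>} = \<Union>((\<lambda>K. {z \<in> topspace Z. r `` {z} \<in> K}) ` \<K>)"
      by blast
    then show "openin Z {z \<in> topspace Z. r `` {z} \<in> \<Union>\<K>}"
      using K by auto
  qed
  then show ?thesis
    by (simp add: quotient_topology_def topology_inverse')
qed

lemma topspace_quotient_topology [simp]: "topspace (quotient_topology Z r) = topspace Z // r"
proof -
  have "{z \<in> topspace Z. r `` {z} \<in> topspace Z // r} = topspace Z"
    by (auto simp: quotient_def)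
  then have "openin (quotient_topology Z r) (topspace Z // r)"
    by (simp add: openin_quotient_topology)
  then show ?thesis
    by (metis openin_quotient_topology openin_subset openin_topspace subset_antisym)
qed

lemma quotient_map_quotient_topology: "quotient_map Z (quotient_topology Z r) (\<lambda>z. r `` {z})"
  by (auto simp: quotient_map_def openin_quotient_topology quotient_def)

definition continuous_section :: "'z topology \<Rightarrow> 'b topology \<Rightarrow> ('z \<Rightarrow> 'b) \<Rightarrow> ('b \<Rightarrow> 'z) \<Rightarrow> bool" where
  "continuous_section Z B p s \<longleftrightarrow> continuous_map B Z s \<and> (\<forall>b \<in> topspace B. p (s b) = b)"

section \<open>Topological groups and partial actions\<close>

locale topological_group = group G for G :: "('g, 'm) monoid_scheme" (structure) +
  fixes T :: "'g topology"
  assumes topspace_group: "topspace T = carrier G"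
    and continuous_mult: "continuous_map (prod_topology T T) T (\<lambda>(g, h). g \<otimes> h)"
    and continuous_inv: "continuous_map T T (\<lambda>g. inv g)"

text \<open>A partially defined map from \<open>G \<times> X\<close> to \<open>X\<close> is a function with values in an option type:
  \<open>act g x = Some y\<close> means that \<open>g\<cdot>x\<close> is defined and equal to \<open>y\<close>. It is undefined outside
  \<open>carrier G \<times> X\<close>.\<close>

locale partial_action = group G for G :: "('g, 'm) monoid_scheme" (structure) +
  fixes X :: "'x set" and act :: "'g \<Rightarrow> 'x \<Rightarrow> 'x option"
  assumes act_closed: "act g x = Some y \<Longrightarrow> g \<in> carrier G \<and> x \<in> X \<and> y \<in> X"
    and PA1: "act g x = Some y \<Longrightarrow> act (inv g) y = Some x"
    and PA2: "act h x = Some y \<Longrightarrow> act g y = Some z \<Longrightarrow> act (g \<otimes> h) x = Some z"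
    and PA3: "x \<in> X \<Longrightarrow> act \<one> x = Some x"

text \<open>The set \<open>X\<^sub>g\<close>, on which \<open>g\<inverse>\<close> is defined; it is the range of \<open>g\<close>.\<close>

definition pa_ran :: "('g, 'm) monoid_scheme \<Rightarrow> 'x set \<Rightarrow> ('g \<Rightarrow> 'x \<Rightarrow> 'x option) \<Rightarrow> 'g \<Rightarrow> 'x set" where
  "pa_ran G X act g = {x \<in> X. act (inv\<^bsub>G\<^esub> g) x \<noteq> None}"

text \<open>The domain \<open>G * X\<close>.\<close>

definition pa_graph_dom :: "('g, 'm) monoid_scheme \<Rightarrow> 'x set \<Rightarrow> ('g \<Rightarrow> 'x \<Rightarrow> 'x option) \<Rightarrow> ('g \<times> 'x) set" where
  "pa_graph_dom G X act = {(g, x) \<in> carrier G \<times> X. act g x \<noteq> None}"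

locale topological_partial_action =
  topological_group G T + partial_action G "topspace X" act
  for G :: "('g, 'm) monoid_scheme" (structure) and T :: "'g topology"
    and X :: "'x topology" and act :: "'g \<Rightarrow> 'x \<Rightarrow> 'x option" +
  assumes openin_pa_ran: "g \<in> carrier G \<Longrightarrow> openin X (pa_ran G (topspace X) act g)"
    and homeomorphic_act: "g \<in> carrier G \<Longrightarrow>
      homeomorphic_map (subtopology X (pa_ran G (topspace X) act (inv g)))
                       (subtopology X (pa_ran G (topspace X) act g)) (\<lambda>x. the (act g x))"

locale continuous_partial_action = topological_partial_action +
  assumes continuous_act:
    "continuous_map (subtopology (prod_topology T X) (pa_graph_dom G (topspace X) act)) X
       (\<lambda>(g, x). the (act g x))"

definition orbit_rel :: "('g, 'm) monoid_scheme \<Rightarrow> ('g \<Rightarrow> 'z \<Rightarrow> 'z option) \<Rightarrow> ('z \<times> 'z) set" where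
  "orbit_rel G act = {(z, w). \<exists>g \<in> carrier G. act g z = Some w}"

definition orbit_space ::
  "('g, 'm) monoid_scheme \<Rightarrow> 'z topology \<Rightarrow> ('g \<Rightarrow> 'z \<Rightarrow> 'z option) \<Rightarrow> 'z set topology" where
  "orbit_space G Z act = quotient_topology Z (orbit_rel G act)"

definition orbit_map :: "('g, 'm) monoid_scheme \<Rightarrow> ('g \<Rightarrow> 'z \<Rightarrow> 'z option) \<Rightarrow> 'z \<Rightarrow> 'z set" where
  "orbit_map G act z = orbit_rel G act `` {z}"

section \<open>The enveloping space and the enveloping action\<close>

definition env_rel :: "('g, 'm) monoid_scheme \<Rightarrow> 'x set \<Rightarrow> ('g \<Rightarrow> 'x \<Rightarrow> 'x option) \<Rightarrow>
    (('g \<times> 'x) \<times> ('g \<times> 'x)) set" where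
  "env_rel G X act = {((g, x), (h, y)). g \<in> carrier G \<and> h \<in> carrier G \<and>
     x \<in> pa_ran G X act (inv\<^bsub>G\<^esub> g \<otimes>\<^bsub>G\<^esub> h) \<and> act (inv\<^bsub>G\<^esub> h \<otimes>\<^bsub>G\<^esub> g) x = Some y}"

definition env_class :: "('g, 'm) monoid_scheme \<Rightarrow> 'x set \<Rightarrow> ('g \<Rightarrow> 'x \<Rightarrow> 'x option) \<Rightarrow>
    'g \<Rightarrow> 'x \<Rightarrow> ('g \<times> 'x) set" where
  "env_class G X act g x = env_rel G X act `` {(g, x)}"

definition env_space :: "('g, 'm) monoid_scheme \<Rightarrow> 'g topology \<Rightarrow> 'x topology \<Rightarrow>
    ('g \<Rightarrow> 'x \<Rightarrow> 'x option) \<Rightarrow> ('g \<times> 'x) set topology" where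
  "env_space G T X act = quotient_topology (prod_topology T X) (env_rel G (topspace X) act)"

definition env_embed :: "('g, 'm) monoid_scheme \<Rightarrow> 'x set \<Rightarrow> ('g \<Rightarrow> 'x \<Rightarrow> 'x option) \<Rightarrow>
    'x \<Rightarrow> ('g \<times> 'x) set" where
  "env_embed G X act x = env_class G X act \<one>\<^bsub>G\<^esub> x"

text \<open>The map \<open>(g, [h, x]) \<mapsto> [gh, x]\<close>, as a union over the representatives of a class; by
  \<open>env_act_class\<close> below all members of the union coincide. It is a global action, regarded as a
  partial one.\<close>

definition env_act :: "('g, 'm) monoid_scheme \<Rightarrow> 'x set \<Rightarrow> ('g \<Rightarrow> 'x \<Rightarrow> 'x option) \<Rightarrow>
    'g \<Rightarrow> ('g \<times> 'x) set \<Rightarrow> ('g \<times> 'x) set option" where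
  "env_act G X act g c =
     (if g \<in> carrier G \<and> c \<in> (carrier G \<times> X) // env_rel G X act
      then Some (\<Union>(h, x) \<in> c. env_class G X act (g \<otimes>\<^bsub>G\<^esub> h) x) else None)"

text \<open>The partial action \<open>g\<cdot>(h, x) = (h g\<inverse>, g\<cdot>x)\<close> of \<open>G\<close> on \<open>G \<times> X\<close>, defined when \<open>g\<cdot>x\<close> is.\<close>

definition hat_act :: "('g, 'm) monoid_scheme \<Rightarrow> ('g \<Rightarrow> 'x \<Rightarrow> 'x option) \<Rightarrow>
    'g \<Rightarrow> 'g \<times> 'x \<Rightarrow> ('g \<times> 'x) option" where
  "hat_act G act g = (\<lambda>(h, x). if g \<in> carrier G \<and> h \<in> carrier G
     then map_option (\<lambda>y. (h \<otimes>\<^bsub>G\<^esub> inv\<^bsub>G\<^esub> g, y)) (act g x) else None)"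

context partial_action
begin

lemma env_rel_iff:
  "((g, x), (h, y)) \<in> env_rel G X act \<longleftrightarrow>
     g \<in> carrier G \<and> h \<in> carrier G \<and> act (inv h \<otimes> g) x = Some y"
  using act_closed by (auto simp: env_rel_def pa_ran_def inv_mult_group)

lemma equiv_orbit_rel: "equiv X (orbit_rel G act)"
proof (rule equivI)
  show "orbit_rel G act \<subseteq> X \<times> X"
    using act_closed by (auto simp: orbit_rel_def)
  show "refl_on X (orbit_rel G act)"
    using PA3 by (auto simp: orbit_rel_def refl_on_def)
  show "sym (orbit_rel G act)"
    using PA1 by (fastforce simp: orbit_rel_def sym_def)
  show "trans (orbit_rel G act)"
    using PA2 unfolding orbit_rel_def trans_def by (blast intro: m_closed)
qed

lemma partial_action_hat_act: "partial_action G (carrier G \<times> X) (hat_act G act)"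
proof unfold_locales
  show "g \<in> carrier G \<and> a \<in> carrier G \<times> X \<and> b \<in> carrier G \<times> X"
    if "hat_act G act g a = Some b" for g a b
    using that act_closed by (auto simp: hat_act_def split: if_splits prod.splits)
  show "hat_act G act (inv g) b = Some a" if "hat_act G act g a = Some b" for g a b
    using that PA1 by (auto simp: hat_act_def m_assoc split: if_splits prod.splits)
  show "hat_act G act (g \<otimes> h) a = Some c"
    if "hat_act G act h a = Some b" "hat_act G act g b = Some c" for h a b g c
    using that PA2 by (auto simp: hat_act_def m_assoc inv_mult_group split: if_splits prod.splits)
  show "hat_act G act \<one> a = Some a" if "a \<in> carrier G \<times> X" for a
    using that PA3 by (auto simp: hat_act_def)
qed

text \<open>The orbit equivalence relation of \<open>hat_act\<close> is the relation defining the enveloping space.\<close>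

lemma orbit_rel_hat_act: "orbit_rel G (hat_act G act) = env_rel G X act"
proof -
  have "(\<exists>k \<in> carrier G. hat_act G act k (g, x) = Some (h, y)) \<longleftrightarrow>
      g \<in> carrier G \<and> h \<in> carrier G \<and> act (inv h \<otimes> g) x = Some y" for g x h y
  proof
    assume "\<exists>k \<in> carrier G. hat_act G act k (g, x) = Some (h, y)"
    then obtain k where k: "k \<in> carrier G" "g \<in> carrier G" "h = g \<otimes> inv k" "act k x = Some y"
      by (auto simp: hat_act_def split: if_splits)
    then have "inv h \<otimes> g = k"
      by (simp add: inv_mult_group m_assoc)
    with k show "g \<in> carrier G \<and> h \<in> carrier G \<and> act (inv h \<otimes> g) x = Some y"
      by auto
  next
    assume a: "g \<in> carrier G \<and> h \<in> carrier G \<and> act (inv h \<otimes> g) x = Some y"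
    then have "g \<otimes> inv (inv h \<otimes> g) = h"
      by (simp add: inv_mult_group flip: m_assoc)
    with a have "hat_act G act (inv h \<otimes> g) (g, x) = Some (h, y)"
      by (simp add: hat_act_def)
    with a show "\<exists>k \<in> carrier G. hat_act G act k (g, x) = Some (h, y)"
      by blast
  qed
  then have "p \<in> orbit_rel G (hat_act G act) \<longleftrightarrow> p \<in> env_rel G X act" for p
    by (cases p; cases "fst p"; cases "snd p") (simp add: orbit_rel_def env_rel_iff)
  then show ?thesis
    by blast
qed

lemma equiv_env_rel: "equiv (carrier G \<times> X) (env_rel G X act)"
  using partial_action.equiv_orbit_rel [OF partial_action_hat_act]
  by (simp add: orbit_rel_hat_act)

lemma env_act_class:
  assumes g: "g \<in> carrier G" and h: "h \<in> carrier G" and x: "x \<in> X"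
  shows "env_act G X act g (env_class G X act h x) = Some (env_class G X act (g \<otimes> h) x)"
proof -
  let ?c = "env_class G X act h x"
  have "env_class G X act (g \<otimes> k) y = env_class G X act (g \<otimes> h) x" if "(k, y) \<in> ?c" for k y
  proof -
    from that have k: "k \<in> carrier G" "act (inv k \<otimes> h) x = Some y"
      by (auto simp: env_class_def env_rel_iff)
    have "inv g \<otimes> (g \<otimes> h) = h"
      using g h by (simp flip: m_assoc)
    then have "inv (g \<otimes> k) \<otimes> (g \<otimes> h) = inv k \<otimes> h"
      using g h k by (simp add: inv_mult_group m_assoc)
    then have "((g \<otimes> h, x), (g \<otimes> k, y)) \<in> env_rel G X act"
      using g h k by (simp add: env_rel_iff)
    then show ?thesis
      using equiv_class_eq [OF equiv_env_rel] by (simp add: env_class_def)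
  qed
  moreover have "(h, x) \<in> ?c"
    using h x PA3 by (simp add: env_class_def env_rel_iff)
  ultimately have "(\<Union>(k, y) \<in> ?c. env_class G X act (g \<otimes> k) y) = env_class G X act (g \<otimes> h) x"
    by blast
  moreover have "?c \<in> (carrier G \<times> X) // env_rel G X act"
    using h x by (auto simp: env_class_def intro: quotientI)
  ultimately show ?thesis
    using g by (simp add: env_act_def)
qed

end

lemma (in topological_partial_action) orbit_space_hat_act:
  "orbit_space G (prod_topology T X) (hat_act G act) = env_space G T X act"
  by (simp add: orbit_space_def env_space_def orbit_rel_hat_act)

end

theory Submission
  imports Defs
begin

text \<open>The map \<open>\<iota>\<close> and the well-defined map \<open>[g, x] \<mapsto> orbit of x\<close> identify \<open>X/\<sim>\<close> with \<open>X\<^sub>G/\<sim>\<close>. Indeed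
  the orbit of \<open>[g, x]\<close> under the enveloping action is \<open>{[k, x] | k \<in> G}\<close>, and two such orbits, over \<open>x\<close>
  and over \<open>y\<close>, are equal exactly when \<open>x\<close> and \<open>y\<close> lie in the same orbit of the partial action
  (\<open>orbit_map_env_act_eq_iff\<close>). By the universal property of quotient spaces there are therefore
  continuous maps \<open>\<phi> : X/\<sim> \<rightarrow> X\<^sub>G/\<sim>\<close> and \<open>\<psi> : X\<^sub>G/\<sim> \<rightarrow> X/\<sim>\<close> with
  \<open>\<phi> (orbit of x) = orbit of \<iota> x\<close> and \<open>\<psi> (orbit of [g, x]) = orbit of x\<close>; they are inverse to each other.

  Sections are transported along these maps. A section \<open>s\<close> of \<open>\<pi>\<^sub>G\<close> gives the section
  \<open>\<iota> \<circ> s \<circ> \<psi>\<close> of \<open>\<Pi>\<^sub>G\<close>. Conversely, given a section \<open>q\<close> of \<open>\<Pi>\<^sub>G\<close>, the map \<open>q \<circ> \<phi>\<close> chooses a point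
  \<open>[g, y]\<close> of \<open>X\<^sub>G\<close> over each orbit of \<open>X\<close>, and any \<open>y\<close> occurring in a representative lies in that
  orbit; only a continuous choice of representatives is missing (\<open>section_of_env_section\<close>). A section
  of the quotient map \<open>G \<times> X \<rightarrow> X\<^sub>G\<close> provides one. If \<open>G * X\<close> is open, then \<open>\<iota>\<close> is an open map
  (\<open>open_map_env_embed\<close>) and, being injective, an embedding, so that \<open>\<iota>\<inverse>\<close> provides one on
  \<open>\<iota>(X)\<close>.\<close>

section \<open>Orbits of the enveloping action\<close>

context partial_action
begin

lemma orbit_map_eq_iff:
  assumes "x \<in> X" "y \<in> X"
  shows "orbit_map G act x = orbit_map G act y \<longleftrightarrow> (\<exists>g \<in> carrier G. act g x = Some y)"
  using eq_equiv_class_iff [OF equiv_orbit_rel assms] by (simp add: orbit_map_def orbit_rel_def)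

lemma env_class_eq_iff:
  assumes "g \<in> carrier G" "h \<in> carrier G" "x \<in> X" "y \<in> X"
  shows "env_class G X act g x = env_class G X act h y \<longleftrightarrow> act (inv h \<otimes> g) x = Some y"
  using eq_equiv_class_iff [OF equiv_env_rel, of "(g, x)" "(h, y)"] assms
  by (simp add: env_class_def env_rel_iff)

lemma env_class_eq_env_embed_iff:
  assumes "g \<in> carrier G" "x \<in> X" "y \<in> X"
  shows "env_class G X act g x = env_embed G X act y \<longleftrightarrow> act g x = Some y"
  using env_class_eq_iff [of g \<one> x y] assms by (auto simp: env_embed_def)

lemma inj_on_env_embed: "inj_on (env_embed G X act) X"
proof (rule inj_onI)
  fix x y
  assume "x \<in> X" "y \<in> X" "env_embed G X act x = env_embed G X act y"
  then have "act \<one> x = Some y"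
    using env_class_eq_env_embed_iff [of \<one> x y] by (simp add: env_embed_def)
  then show "x = y"
    using PA3 \<open>x \<in> X\<close> by simp
qed

lemma env_quotient_cases:
  assumes "c \<in> (carrier G \<times> X) // env_rel G X act"
  obtains g x where "g \<in> carrier G" "x \<in> X" "c = env_class G X act g x"
  using assms by (auto simp: quotient_def env_class_def)

lemma orbit_map_env_act:
  assumes "g \<in> carrier G" "x \<in> X"
  shows "orbit_map G (env_act G X act) (env_class G X act g x) =
    (\<lambda>k. env_class G X act k x) ` carrier G"
proof -
  have "\<exists>h \<in> carrier G. k = h \<otimes> g" if "k \<in> carrier G" for k
    using that assms by (intro bexI [of _ "k \<otimes> inv g"]) (auto simp: m_assoc)
  then show ?thesis
    using assms by (fastforce simp: orbit_map_def orbit_rel_def env_act_class)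
qed

text \<open>If \<open>y = k\<cdot>x\<close>, then \<open>[h, y] = [h k, x]\<close> for all \<open>h\<close>, so the two orbits agree; and if \<open>[\<one>, y]\<close>
  lies in the orbit \<open>{[k, x] | k \<in> G}\<close>, then \<open>y = k\<cdot>x\<close> for some \<open>k\<close>.\<close>

lemma orbit_map_env_act_eq_iff:
  assumes "g \<in> carrier G" "h \<in> carrier G" "x \<in> X" "y \<in> X"
  shows "orbit_map G (env_act G X act) (env_class G X act g x) =
      orbit_map G (env_act G X act) (env_class G X act h y) \<longleftrightarrow>
    orbit_map G act x = orbit_map G act y"
proof
  assume "orbit_map G (env_act G X act) (env_class G X act g x) =
      orbit_map G (env_act G X act) (env_class G X act h y)"
  then have "env_class G X act \<one> y \<in> (\<lambda>k. env_class G X act k x) ` carrier G"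
    using assms by (auto simp: orbit_map_env_act)
  then obtain k where k: "k \<in> carrier G" "env_class G X act k x = env_embed G X act y"
    by (auto simp: env_embed_def)
  then have "act k x = Some y"
    using assms by (simp add: env_class_eq_env_embed_iff)
  with k show "orbit_map G act x = orbit_map G act y"
    using assms by (auto simp: orbit_map_eq_iff)
next
  have sub: "(\<lambda>k. env_class G X act k v) ` carrier G \<subseteq> (\<lambda>k. env_class G X act k u) ` carrier G"
    if uv: "u \<in> X" "v \<in> X" and eq: "orbit_map G act u = orbit_map G act v" for u v
  proof
    fix c
    assume "c \<in> (\<lambda>k. env_class G X act k v) ` carrier G"
    then obtain l where l: "l \<in> carrier G" "c = env_class G X act l v"
      by blast
    obtain k where k: "k \<in> carrier G" "act k u = Some v"
      using uv eq by (auto simp: orbit_map_eq_iff)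
    have "inv l \<otimes> (l \<otimes> k) = k"
      using k l by (simp flip: m_assoc)
    then have "env_class G X act (l \<otimes> k) u = c"
      using k l uv by (simp add: env_class_eq_iff)
    then show "c \<in> (\<lambda>k. env_class G X act k u) ` carrier G"
      using k l by blast
  qed
  assume "orbit_map G act x = orbit_map G act y"
  then show "orbit_map G (env_act G X act) (env_class G X act g x) =
      orbit_map G (env_act G X act) (env_class G X act h y)"
    using assms sub [of x y] sub [of y x] by (simp add: orbit_map_env_act)
qed

end

section \<open>Continuous maps between the two orbit spaces\<close>

lemma quotient_map_orbit_map: "quotient_map Z (orbit_space G Z a) (orbit_map G a)"
  unfolding orbit_space_def orbit_map_def by (rule quotient_map_quotient_topology)

lemma topspace_orbit_space: "topspace (orbit_space G Z a) = orbit_map G a ` topspace Z"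
  by (rule quotient_imp_surjective_map [OF quotient_map_orbit_map, symmetric])

context topological_partial_action
begin

lemma topspace_env_space:
  "topspace (env_space G T X act) = (carrier G \<times> topspace X) // env_rel G (topspace X) act"
  by (simp add: env_space_def topspace_group)

lemma quotient_map_env_class:
  "quotient_map (prod_topology T X) (env_space G T X act)
     (\<lambda>(g, x). env_class G (topspace X) act g x)"
  using quotient_map_quotient_topology [of "prod_topology T X" "env_rel G (topspace X) act"]
  by (simp add: env_space_def env_class_def case_prod_beta')

lemma continuous_map_env_embed:
  "continuous_map X (env_space G T X act) (env_embed G (topspace X) act)"
proof -
  have "continuous_map X (prod_topology T X) (\<lambda>x. (\<one>, x))"
    by (simp add: continuous_map_pairedI topspace_group)
  then have "continuous_map X (env_space G T X act)
      ((\<lambda>(g, x). env_class G (topspace X) act g x) \<circ> (\<lambda>x. (\<one>, x)))"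
    using quotient_imp_continuous_map [OF quotient_map_env_class] by (rule continuous_map_compose)
  then show ?thesis
    by (simp add: env_embed_def [abs_def] o_def)
qed

lemma orbit_space_to_env_orbit_space:
  obtains \<phi> where
    "continuous_map (orbit_space G X act)
       (orbit_space G (env_space G T X act) (env_act G (topspace X) act)) \<phi>"
    "\<And>x. x \<in> topspace X \<Longrightarrow> \<phi> (orbit_map G act x) =
       orbit_map G (env_act G (topspace X) act) (env_embed G (topspace X) act x)"
proof (rule quotient_map_lift_exists [OF quotient_map_orbit_map [of X G act]])
  show "continuous_map X (orbit_space G (env_space G T X act) (env_act G (topspace X) act))
      (orbit_map G (env_act G (topspace X) act) \<circ> env_embed G (topspace X) act)"
    using continuous_map_env_embed quotient_imp_continuous_map [OF quotient_map_orbit_map]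
    by (rule continuous_map_compose)
qed (use that in \<open>auto simp: env_embed_def orbit_map_env_act_eq_iff\<close>)

text \<open>The projection \<open>G \<times> X \<rightarrow> X\<close> followed by the orbit map factors through the composite
  \<open>G \<times> X \<rightarrow> X\<^sub>G \<rightarrow> X\<^sub>G/\<sim>\<close>: this composite is again a quotient map, and it sends \<open>(g, x)\<close> and \<open>(h, y)\<close> to the same
  point exactly when \<open>x\<close> and \<open>y\<close> lie in one orbit.\<close>

lemma env_orbit_space_to_orbit_space:
  obtains \<psi> where
    "continuous_map (orbit_space G (env_space G T X act) (env_act G (topspace X) act))
       (orbit_space G X act) \<psi>"
    "\<And>g x. g \<in> carrier G \<Longrightarrow> x \<in> topspace X \<Longrightarrow>
       \<psi> (orbit_map G (env_act G (topspace X) act) (env_class G (topspace X) act g x)) =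
       orbit_map G act x"
proof (rule quotient_map_lift_exists
    [OF quotient_map_compose [OF quotient_map_env_class
        quotient_map_orbit_map [of _ G "env_act G (topspace X) act"]]])
  show "continuous_map (prod_topology T X) (orbit_space G X act) (orbit_map G act \<circ> snd)"
    using continuous_map_snd quotient_imp_continuous_map [OF quotient_map_orbit_map]
    by (rule continuous_map_compose)
qed (use that in \<open>auto simp: topspace_group orbit_map_env_act_eq_iff\<close>)

end

section \<open>The embedding into the enveloping space\<close>

context continuous_partial_action
begin

text \<open>The preimage of \<open>\<iota>(U)\<close> in \<open>G \<times> X\<close> is \<open>{(g, x) | g\<cdot>x is defined and lies in U}\<close>, the preimage of
  \<open>U\<close> under the partial action; by continuity it is open in \<open>G * X\<close>.\<close>

lemma open_map_env_embed:
  assumes "openin (prod_topology T X) (pa_graph_dom G (topspace X) act)"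
  shows "open_map X (env_space G T X act) (env_embed G (topspace X) act)"
proof (unfold open_map_def, intro allI impI)
  fix U
  assume U: "openin X U"
  let ?D = "pa_graph_dom G (topspace X) act"
  let ?\<iota> = "env_embed G (topspace X) act"
  have "openin (subtopology (prod_topology T X) ?D)
      {p \<in> topspace (subtopology (prod_topology T X) ?D). (case p of (g, x) \<Rightarrow> the (act g x)) \<in> U}"
    using continuous_act U by (rule openin_continuous_map_preimage)
  then have "openin (prod_topology T X)
      {p \<in> topspace (subtopology (prod_topology T X) ?D). (case p of (g, x) \<Rightarrow> the (act g x)) \<in> U}"
    using assms openin_trans_full by blast
  also have "{p \<in> topspace (subtopology (prod_topology T X) ?D).
        (case p of (g, x) \<Rightarrow> the (act g x)) \<in> U} =
      {p \<in> topspace (prod_topology T X).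
        (case p of (g, x) \<Rightarrow> env_class G (topspace X) act g x) \<in> ?\<iota> ` U}"
  proof -
    have "env_class G (topspace X) act g x \<in> ?\<iota> ` U \<longleftrightarrow> (\<exists>y \<in> U. act g x = Some y)"
      if "g \<in> carrier G" "x \<in> topspace X" for g x
      unfolding image_iff using that openin_subset [OF U]
      by (intro bex_cong refl env_class_eq_env_embed_iff) auto
    then show ?thesis
      \<comment> \<open>The membership in the image is to be rewritten by the equivalence just shown, not taken apart.\<close>
      by (auto simp: pa_graph_dom_def topspace_group del: imageE image_eqI)
  qed
  finally have "openin (prod_topology T X) {p \<in> topspace (prod_topology T X).
      (case p of (g, x) \<Rightarrow> env_class G (topspace X) act g x) \<in> ?\<iota> ` U}" .
  moreover have "?\<iota> ` U \<subseteq> topspace (env_space G T X act)"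
    using openin_subset [OF U] continuous_map_image_subset_topspace [OF continuous_map_env_embed]
    by blast
  ultimately show "openin (env_space G T X act) (?\<iota> ` U)"
    using quotient_map_env_class by (simp add: quotient_map_def)
qed

section \<open>Transport of sections\<close>

lemma env_section_of_section:
  assumes "continuous_section X (orbit_space G X act) (orbit_map G act) s"
  shows "\<exists>s'. continuous_section (env_space G T X act)
    (orbit_space G (env_space G T X act) (env_act G (topspace X) act))
    (orbit_map G (env_act G (topspace X) act)) s'"
proof -
  let ?\<mu> = "env_act G (topspace X) act"
  let ?\<iota> = "env_embed G (topspace X) act"
  have s: "continuous_map (orbit_space G X act) X s"
    and s_orbit: "\<And>x. x \<in> topspace X \<Longrightarrow> orbit_map G act (s (orbit_map G act x)) = orbit_map G act x"
    using assms by (auto simp: continuous_section_def topspace_orbit_space)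
  obtain \<psi> where \<psi>: "continuous_map (orbit_space G (env_space G T X act) ?\<mu>) (orbit_space G X act) \<psi>"
    and \<psi>_orbit: "\<And>g x. g \<in> carrier G \<Longrightarrow> x \<in> topspace X \<Longrightarrow>
      \<psi> (orbit_map G ?\<mu> (env_class G (topspace X) act g x)) = orbit_map G act x"
    by (rule env_orbit_space_to_orbit_space) blast
  have "continuous_section (env_space G T X act) (orbit_space G (env_space G T X act) ?\<mu>)
      (orbit_map G ?\<mu>) (?\<iota> \<circ> s \<circ> \<psi>)"
    unfolding continuous_section_def
  proof
    show "continuous_map (orbit_space G (env_space G T X act) ?\<mu>) (env_space G T X act)
        (?\<iota> \<circ> s \<circ> \<psi>)"
      using continuous_map_compose [OF continuous_map_compose [OF \<psi> s] continuous_map_env_embed]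
      by (simp add: comp_assoc)
    show "\<forall>b \<in> topspace (orbit_space G (env_space G T X act) ?\<mu>).
        orbit_map G ?\<mu> ((?\<iota> \<circ> s \<circ> \<psi>) b) = b"
    proof
      fix b
      assume "b \<in> topspace (orbit_space G (env_space G T X act) ?\<mu>)"
      then obtain g x where gx: "g \<in> carrier G" "x \<in> topspace X"
        and b: "b = orbit_map G ?\<mu> (env_class G (topspace X) act g x)"
        by (auto simp: topspace_orbit_space topspace_env_space elim!: env_quotient_cases)
      have "s (orbit_map G act x) \<in> topspace X"
        using s gx(2) by (auto simp: continuous_map_def topspace_orbit_space)
      then show "orbit_map G ?\<mu> ((?\<iota> \<circ> s \<circ> \<psi>) b) = b"
        using gx by (simp add: b \<psi>_orbit env_embed_def orbit_map_env_act_eq_iff s_orbit)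
    qed
  qed
  then show ?thesis
    by blast
qed

text \<open>Here \<open>r\<close> chooses, continuously on the image of \<open>q\<close>, the second component of a representative of a
  point of \<open>X\<^sub>G\<close>. Two such choices are used: \<open>\<iota>\<inverse>\<close>, and the second component of a section of the
  quotient map \<open>G \<times> X \<rightarrow> X\<^sub>G\<close>.\<close>

lemma section_of_env_section:
  fixes q
  defines "Q \<equiv> q ` topspace (orbit_space G (env_space G T X act) (env_act G (topspace X) act))"
  assumes q: "continuous_section (env_space G T X act)
      (orbit_space G (env_space G T X act) (env_act G (topspace X) act))
      (orbit_map G (env_act G (topspace X) act)) q"
    and r: "continuous_map (subtopology (env_space G T X act) Q) X r"
    and r_repr: "\<And>c. c \<in> Q \<Longrightarrow> \<exists>g \<in> carrier G. c = env_class G (topspace X) act g (r c)"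
  shows "\<exists>s. continuous_section X (orbit_space G X act) (orbit_map G act) s"
proof -
  let ?\<mu> = "env_act G (topspace X) act"
  let ?\<iota> = "env_embed G (topspace X) act"
  let ?B = "orbit_space G (env_space G T X act) ?\<mu>"
  obtain \<phi> where \<phi>: "continuous_map (orbit_space G X act) ?B \<phi>"
    and \<phi>_orbit: "\<And>x. x \<in> topspace X \<Longrightarrow> \<phi> (orbit_map G act x) = orbit_map G ?\<mu> (?\<iota> x)"
    by (rule orbit_space_to_env_orbit_space) blast
  have q_cont: "continuous_map ?B (subtopology (env_space G T X act) Q) q"
    using q by (auto simp: continuous_section_def continuous_map_in_subtopology Q_def)
  have "continuous_section X (orbit_space G X act) (orbit_map G act) (r \<circ> q \<circ> \<phi>)"
    unfolding continuous_section_def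
  proof
    show "continuous_map (orbit_space G X act) X (r \<circ> q \<circ> \<phi>)"
      using continuous_map_compose [OF \<phi> continuous_map_compose [OF q_cont r]]
      by (simp add: comp_assoc)
    show "\<forall>b \<in> topspace (orbit_space G X act). orbit_map G act ((r \<circ> q \<circ> \<phi>) b) = b"
    proof
      fix b
      assume "b \<in> topspace (orbit_space G X act)"
      then obtain x where x: "x \<in> topspace X" and b: "b = orbit_map G act x"
        by (auto simp: topspace_orbit_space)
      define c where "c = q (\<phi> b)"
      have \<phi>b: "\<phi> b \<in> topspace ?B"
        using x \<open>b \<in> topspace _\<close> \<phi> by (auto simp: continuous_map_def)
      then have c: "c \<in> topspace (subtopology (env_space G T X act) Q)"
        using q_cont by (auto simp: c_def continuous_map_def)
      then have rc: "r c \<in> topspace X"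
        using r by (auto simp: continuous_map_def)
      obtain g where g: "g \<in> carrier G" "c = env_class G (topspace X) act g (r c)"
        using r_repr c by auto
      have "orbit_map G ?\<mu> c = orbit_map G ?\<mu> (?\<iota> x)"
        using q \<phi>b x by (simp add: continuous_section_def c_def b \<phi>_orbit)
      then have "orbit_map G ?\<mu> (env_class G (topspace X) act g (r c)) =
          orbit_map G ?\<mu> (env_class G (topspace X) act \<one> x)"
        using g(2) by (simp add: env_embed_def)
      then show "orbit_map G act ((r \<circ> q \<circ> \<phi>) b) = b"
        using g(1) rc x by (simp add: orbit_map_env_act_eq_iff c_def b)
    qed
  qed
  then show ?thesis
    by blast
qed

end

theorem proposition3p10:
  fixes G :: "('g, 'm) monoid_scheme" and T :: "'g topology"
    and X :: "'x topology" and \<eta> :: "'g \<Rightarrow> 'x \<Rightarrow> 'x option"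
  assumes "continuous_partial_action G T X \<eta>"
  shows
    "let X\<^sub>G = env_space G T X \<eta>;
         \<mu> = env_act G (topspace X) \<eta>;
         \<iota> = env_embed G (topspace X) \<eta>;
         GX = prod_topology T X;
         \<eta>h = hat_act G \<eta>
     in
       ((\<exists>s. continuous_section X (orbit_space G X \<eta>) (orbit_map G \<eta>) s) \<longrightarrow>
         (\<exists>s. continuous_section X\<^sub>G (orbit_space G X\<^sub>G \<mu>) (orbit_map G \<mu>) s)) \<and>
       (\<forall>q. openin GX (pa_graph_dom G (topspace X) \<eta>) \<and>
         continuous_section X\<^sub>G (orbit_space G X\<^sub>G \<mu>) (orbit_map G \<mu>) q \<and>
         q ` topspace (orbit_space G X\<^sub>G \<mu>) \<subseteq> \<iota> ` topspace X \<longrightarrow>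
         (\<exists>s. continuous_section X (orbit_space G X \<eta>) (orbit_map G \<eta>) s)) \<and>
       ((\<exists>s. continuous_section X\<^sub>G (orbit_space G X\<^sub>G \<mu>) (orbit_map G \<mu>) s) \<and>
         (\<exists>s. continuous_section GX (orbit_space G GX \<eta>h) (orbit_map G \<eta>h) s) \<longrightarrow>
         (\<exists>s. continuous_section X (orbit_space G X \<eta>) (orbit_map G \<eta>) s))"
proof -
  interpret continuous_partial_action G T X \<eta>
    by (rule assms)
  let ?XG = "env_space G T X \<eta>"
  let ?\<mu> = "env_act G (topspace X) \<eta>"
  let ?\<iota> = "env_embed G (topspace X) \<eta>"
  have ii: "\<exists>s. continuous_section X (orbit_space G X \<eta>) (orbit_map G \<eta>) s"
    if D: "openin (prod_topology T X) (pa_graph_dom G (topspace X) \<eta>)"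
      and q: "continuous_section ?XG (orbit_space G ?XG ?\<mu>) (orbit_map G ?\<mu>) q"
      and im: "q ` topspace (orbit_space G ?XG ?\<mu>) \<subseteq> ?\<iota> ` topspace X" for q
  proof -
    have "embedding_map X ?XG ?\<iota>"
      using continuous_map_env_embed open_map_env_embed [OF D] inj_on_env_embed
      by (rule injective_open_imp_embedding_map)
    then obtain r where r: "homeomorphic_maps X (subtopology ?XG (?\<iota> ` topspace X)) ?\<iota> r"
      by (auto simp: embedding_map_def homeomorphic_map_maps)
    then have "continuous_map (subtopology ?XG (?\<iota> ` topspace X)) X r"
      by (simp add: homeomorphic_maps_def)
    then have "continuous_map (subtopology ?XG (q ` topspace (orbit_space G ?XG ?\<mu>))) X r"
      using im by (rule continuous_map_from_subtopology_mono)
    moreover have "\<exists>g \<in> carrier G. c = env_class G (topspace X) \<eta> g (r c)"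
      if c: "c \<in> q ` topspace (orbit_space G ?XG ?\<mu>)" for c
    proof -
      obtain x where "c = ?\<iota> x" "x \<in> topspace X"
        using im c by blast
      moreover from this have "r c = x"
        using r by (simp add: homeomorphic_maps_def)
      ultimately show ?thesis
        by (auto simp: env_embed_def)
    qed
    ultimately show ?thesis
      by (rule section_of_env_section [OF q])
  qed
  have iii: "\<exists>s. continuous_section X (orbit_space G X \<eta>) (orbit_map G \<eta>) s"
    if q: "continuous_section ?XG (orbit_space G ?XG ?\<mu>) (orbit_map G ?\<mu>) q"
      and t: "continuous_section (prod_topology T X)
        (orbit_space G (prod_topology T X) (hat_act G \<eta>)) (orbit_map G (hat_act G \<eta>)) t" for q t
  proof (rule section_of_env_section [OF q])
    have t_cont: "continuous_map ?XG (prod_topology T X) t"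
      and t_class: "\<And>c. c \<in> topspace ?XG \<Longrightarrow> orbit_map G (hat_act G \<eta>) (t c) = c"
      using t by (auto simp: continuous_section_def orbit_space_hat_act)
    show "continuous_map (subtopology ?XG (q ` topspace (orbit_space G ?XG ?\<mu>))) X (snd \<circ> t)"
      by (intro continuous_map_from_subtopology continuous_map_compose [OF t_cont continuous_map_snd])
    show "\<exists>g \<in> carrier G. c = env_class G (topspace X) \<eta> g ((snd \<circ> t) c)"
      if "c \<in> q ` topspace (orbit_space G ?XG ?\<mu>)" for c
    proof -
      have c: "c \<in> topspace ?XG"
        using that q by (auto simp: continuous_section_def continuous_map_def)
      then have "fst (t c) \<in> carrier G"
        using t_cont by (auto simp: continuous_map_def topspace_group Pi_iff mem_Times_iff)
      moreover have "c = env_class G (topspace X) \<eta> (fst (t c)) (snd (t c))"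
        using t_class [OF c] by (simp add: orbit_map_def env_class_def orbit_rel_hat_act)
      ultimately show ?thesis
        by auto
    qed
  qed
  show ?thesis
    unfolding Let_def using env_section_of_section ii iii by blast
qed

end
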